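(* Let $f:\mathbb{R}\to\mathbb{R}$ be a $\mathcal{C}^\infty$ function all of whose derivatives grow at most polynomially at infinity, and suppose $f''>0$ on $\mathbb{R}$. Let $\mu\in(0,1]$ and let $p_1$ be a finite real number. Let $u_0$ be a tempered distribution on $\mathbb{R}$ with $\mathcal{F}u_0\in L^1(\mathbb{R})$, and suppose there is a bounded differentiable function $\tilde u:\mathbb{R}\to\mathbb{C}$ with $\tilde u'\in L^1(\mathbb{R})$, and with $\tilde u(p_1)\neq0$ if $\mu\neq1$, such that $$\mathcal{F}u_0(p)=|p-p_1|^{\mu-1}\,\tilde u(p)\qquad\text{for all }p\in\mathbb{R}\setminus\{p_1\}.$$ Let $u$ be the solution of $[i\partial_t-f(D)]u=0$, $u(0,\cdot)=u_0$, given by $$u(t,x)=\frac{1}{2\pi}\int_{\mathbb{R}}\mathcal{F}u_0(p)\,e^{-itf(p)+ixp}\,dp ,\qquad t>0,\ x\in\mathbb{R}.$$ Let $\tilde p_1<\tilde p_2$ be finite real numbers such that $p_1\notin[\tilde p_1,\tilde p_2]$, and fix any $\eta\in\big(0,\min\{|\tilde p_1-p_1|,|p_1-\tilde p_2|\}\big)$. Then for all $(t,x)\in\mathfrak{C}\big(f'(\tilde p_1),f'(\tilde p_2)\big)$, $$|u(t,x)|\leqslant c^{(1)}_{\tilde p_1,\tilde p_2}(u_0,f)\,t^{-\frac12}+c^{(2)}_{\tilde p_1,\tilde p_2}(u_0,f)\,t^{-\mu}+c^{(3)}_{\tilde p_1,\tilde p_2}(u_0,f)\,t^{-1}.$$ Here,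 writing $A:=\|\tilde u\|_{L^\infty(\mathbb{R})}$, $B:=4\|\tilde u\|_{L^\infty(\mathbb{R})}+\|\tilde u'\|_{L^1(\mathbb{R})}$, $m_1:=\min_{p\in[\tilde p_1-\eta,\tilde p_2+\eta]}f''(p)>0$, $\tilde m_2:=f'(\tilde p_1)-f'(\tilde p_1-\eta)>0$ and $\tilde m_3:=f'(\tilde p_2+\eta)-f'(\tilde p_2)>0$, the constants are: if $p_1<\tilde p_1$: $$c^{(1)}_{\tilde p_1,\tilde p_2}=\frac{(\tilde p_1-\eta-p_1)^{\mu-1}}{\pi}\big(A+B\,m_1^{-1}\big),\quad c^{(2)}_{\tilde p_1,\tilde p_2}=\frac1\pi\Big(\frac1\mu A+B\,\tilde m_2^{-1}\Big),\quad c^{(3)}_{\tilde p_1,\tilde p_2}=\frac{(\tilde p_2+\eta-p_1)^{\mu-1}}{2\pi}\,B\,\tilde m_3^{-1};$$ if $p_1>\tilde p_2$: $$c^{(1)}_{\tilde p_1,\tilde p_2}=\frac{(p_1-\tilde p_2-\eta)^{\mu-1}}{\pi}\big(A+B\,m_1^{-1}\big),\quad c^{(2)}_{\tilde p_1,\tilde p_2}=\frac1\pi\Big(\frac1\mu A+B\,\tilde m_3^{-1}\Big),\quad c^{(3)}_{\tilde p_1,\tilde p_2}=\frac{(p_1-\tilde p_1+\eta)^{\mu-1}}{2\pi}\,B\,\tilde m_2^{-1}.$$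
   Context: Fourier transform convention: $\mathcal{F}v(p)=\int_{\mathbb{R}}v(x)e^{-ixp}\,dx$, extended to tempered distributions. $f(D)$ is the Fourier multiplier $f(D)v=\mathcal{F}^{-1}(f\,\mathcal{F}v)$. Since $\mathcal{F}u_0\in L^1(\mathbb{R})$, the formula for $u$ is well defined for all $t>0$, $x\in\mathbb{R}$. Space-time cone: for real $a<b$, $\mathfrak{C}(a,b):=\{(t,x)\in(0,+\infty)\times\mathbb{R} : a\leqslant \frac{x}{t}\leqslant b\}$. *)

theory Defs
  imports
    "HOL-Analysis.Analysis"
    "HOL-Library.Landau_Symbols"
    "HOL-Probability.Essential_Supremum"
begin

subsection \<open>Schwartz functions, tempered distributions and their Fourier transform\<close>

definition nth_deriv :: "nat \<Rightarrow> (real \<Rightarrow> complex) \<Rightarrow> real \<Rightarrow> complex" where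
  "nth_deriv k \<phi> = ((\<lambda>\<psi> x. vector_derivative \<psi> (at x)) ^^ k) \<phi>"

definition schwartz :: "(real \<Rightarrow> complex) set" where
  "schwartz = {\<phi>. (\<forall>k x. nth_deriv k \<phi> differentiable (at x)) \<and>
                  (\<forall>j k. bdd_above (range (\<lambda>x. \<bar>x\<bar> ^ j * norm (nth_deriv k \<phi> x))))}"

definition schwartz_seminorm :: "nat \<Rightarrow> nat \<Rightarrow> (real \<Rightarrow> complex) \<Rightarrow> real" where
  "schwartz_seminorm j k \<phi> = (SUP x. \<bar>x\<bar> ^ j * norm (nth_deriv k \<phi> x))"

definition schwartz_topology :: "(real \<Rightarrow> complex) topology" where
  "schwartz_topology = topology_generated_by
     {{\<psi> \<in> schwartz. schwartz_seminorm j k (\<lambda>x. \<psi> x - \<phi> x) < \<epsilon>} | \<phi> j k \<epsilon>.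
        \<phi> \<in> schwartz \<and> \<epsilon> > 0}"

text \<open>A distribution is a functional on all functions of which only the values on
  \<^const>\<open>schwartz\<close> matter.\<close>

definition tempered_distribution :: "((real \<Rightarrow> complex) \<Rightarrow> complex) \<Rightarrow> bool" where
  "tempered_distribution T \<longleftrightarrow>
     (\<forall>\<phi>\<in>schwartz. \<forall>\<psi>\<in>schwartz. T (\<lambda>x. \<phi> x + \<psi> x) = T \<phi> + T \<psi>) \<and>
     (\<forall>c. \<forall>\<phi>\<in>schwartz. T (\<lambda>x. c * \<phi> x) = c * T \<phi>) \<and>
     continuous_map schwartz_topology euclidean T"

definition fourier :: "(real \<Rightarrow> complex) \<Rightarrow> real \<Rightarrow> complex" where
  "fourier v p = (LINT x|lborel. v x * exp (- \<i> * of_real x * of_real p))"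

definition fourier_distribution ::
    "((real \<Rightarrow> complex) \<Rightarrow> complex) \<Rightarrow> (real \<Rightarrow> complex) \<Rightarrow> complex" where
  "fourier_distribution T \<phi> = T (fourier \<phi>)"

definition represents_distribution ::
    "(real \<Rightarrow> complex) \<Rightarrow> ((real \<Rightarrow> complex) \<Rightarrow> complex) \<Rightarrow> bool" where
  "represents_distribution g T \<longleftrightarrow> (\<forall>\<phi>\<in>schwartz. T \<phi> = (LINT p|lborel. g p * \<phi> p))"

subsection \<open>Symbols, norms and the space-time cone\<close>

text \<open>The growth condition includes the derivative of order zero; this is no restriction,
  since polynomial growth of the first derivative implies that of the function.\<close>

definition smooth_poly_growth :: "(real \<Rightarrow> real) \<Rightarrow> bool" where
  "smooth_poly_growth f \<longleftrightarrow>
     (\<forall>n p. (deriv ^^ n) f differentiable (at p)) \<and>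
     (\<forall>n. \<exists>N. (deriv ^^ n) f \<in> O[at_infinity](\<lambda>p. p ^ N))"

definition Linf_norm :: "(real \<Rightarrow> complex) \<Rightarrow> real" where
  "Linf_norm w = real_of_ereal (esssup lborel (\<lambda>p. ereal (norm (w p))))"

definition L1_norm :: "(real \<Rightarrow> complex) \<Rightarrow> real" where
  "L1_norm w = (LINT p|lborel. norm (w p))"

definition space_time_cone :: "real \<Rightarrow> real \<Rightarrow> (real \<times> real) set" where
  "space_time_cone a b = {(t, x). t > 0 \<and> a \<le> x / t \<and> x / t \<le> b}"

subsection \<open>The constants of the estimate\<close>

text \<open>Throughout, \<open>w\<close> is the regular factor of the Fourier transform of the initial datum,
  \<open>q\<close> its singular frequency, and \<open>a < b\<close> are the frequencies defining the cone.\<close>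

definition const_A :: "(real \<Rightarrow> complex) \<Rightarrow> real" where
  "const_A w = Linf_norm w"

definition const_B :: "(real \<Rightarrow> complex) \<Rightarrow> real" where
  "const_B w = 4 * Linf_norm w + L1_norm (\<lambda>p. vector_derivative w (at p))"

definition const_m1 :: "(real \<Rightarrow> real) \<Rightarrow> real \<Rightarrow> real \<Rightarrow> real \<Rightarrow> real" where
  "const_m1 f a b \<eta> = (LEAST y. y \<in> deriv (deriv f) ` {a - \<eta>..b + \<eta>})"

definition const_m2 :: "(real \<Rightarrow> real) \<Rightarrow> real \<Rightarrow> real \<Rightarrow> real" where
  "const_m2 f a \<eta> = deriv f a - deriv f (a - \<eta>)"

definition const_m3 :: "(real \<Rightarrow> real) \<Rightarrow> real \<Rightarrow> real \<Rightarrow> real" where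
  "const_m3 f b \<eta> = deriv f (b + \<eta>) - deriv f b"

text \<open>The \<open>else\<close> branches are only meant for \<open>q > b\<close>.\<close>

definition const_c1 ::
    "(real \<Rightarrow> real) \<Rightarrow> (real \<Rightarrow> complex) \<Rightarrow> real \<Rightarrow> real \<Rightarrow> real \<Rightarrow> real \<Rightarrow> real \<Rightarrow> real" where
  "const_c1 f w \<mu> q a b \<eta> =
     (if q < a
      then (a - \<eta> - q) powr (\<mu> - 1) / pi * (const_A w + const_B w * inverse (const_m1 f a b \<eta>))
      else (q - b - \<eta>) powr (\<mu> - 1) / pi * (const_A w + const_B w * inverse (const_m1 f a b \<eta>)))"

definition const_c2 ::
    "(real \<Rightarrow> real) \<Rightarrow> (real \<Rightarrow> complex) \<Rightarrow> real \<Rightarrow> real \<Rightarrow> real \<Rightarrow> real \<Rightarrow> real \<Rightarrow> real" where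
  "const_c2 f w \<mu> q a b \<eta> =
     (if q < a
      then 1 / pi * (1 / \<mu> * const_A w + const_B w * inverse (const_m2 f a \<eta>))
      else 1 / pi * (1 / \<mu> * const_A w + const_B w * inverse (const_m3 f b \<eta>)))"

definition const_c3 ::
    "(real \<Rightarrow> real) \<Rightarrow> (real \<Rightarrow> complex) \<Rightarrow> real \<Rightarrow> real \<Rightarrow> real \<Rightarrow> real \<Rightarrow> real \<Rightarrow> real" where
  "const_c3 f w \<mu> q a b \<eta> =
     (if q < a
      then (b + \<eta> - q) powr (\<mu> - 1) / (2 * pi) * const_B w * inverse (const_m3 f b \<eta>)
      else (q - a + \<eta>) powr (\<mu> - 1) / (2 * pi) * const_B w * inverse (const_m2 f a \<eta>))"

end

theory Submission
  imports Defs
begin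

text \<open>
  Write the integrand as an amplitude times \<open>exp (- i t \<psi> p)\<close> with
  \<open>\<psi> p = f p - (x / t) p\<close>. For \<open>(t, x)\<close> in the cone, \<open>\<psi>'\<close> has its zero \<open>p0\<close> in \<open>[a, b]\<close>, and the
  line splits at \<open>a - \<eta>\<close> and \<open>b + \<eta>\<close> into three zones. Away from both \<open>p0\<close> and the singular
  frequency \<open>q\<close>, one integration by parts gains the factor \<open>1 / (t m)\<close>, where
  \<open>m \<le> \<bar>\<psi>'\<bar>\<close>. Around \<open>p0\<close> this is applied outside \<open>\<bar>p - p0\<bar> \<le> \<delta>\<close>, where
  \<open>\<bar>\<psi>'\<bar> \<ge> m \<delta>\<close>, and the trivial estimate inside; \<open>\<delta> = t powr (- 1 / 2)\<close> balances the
  two. Around \<open>q\<close> it is applied outside \<open>\<bar>p - q\<bar> \<le> \<delta>\<close>, where the weight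
  \<open>\<bar>p - q\<bar> powr (\<mu> - 1)\<close> is at most \<open>\<delta> powr (\<mu> - 1)\<close>, and \<open>\<delta> = 1 / t\<close> balances.
\<close>

section \<open>Oscillatory integrals with nonvanishing phase derivative\<close>

text \<open>A derivative of constant sign has absolute value \<open>r'\<close> or
  \<open>- r'\<close>, so the fundamental theorem of calculus yields both integrability and the
  value. This turns the variation of a monotone factor into a difference of endpoint values.\<close>

lemma has_integral_abs_derivative:
  fixes r r' :: "real \<Rightarrow> real"
  assumes cd: "c \<le> d"
    and deriv: "\<And>x. x \<in> {c..d} \<Longrightarrow> (r has_real_derivative r' x) (at x)"
    and sign: "(\<forall>x\<in>{c..d}. 0 \<le> r' x) \<or> (\<forall>x\<in>{c..d}. r' x \<le> 0)"
  shows "((\<lambda>x. \<bar>r' x\<bar>) has_integral \<bar>r d - r c\<bar>) {c..d}"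
proof -
  have I: "(r' has_integral (r d - r c)) {c..d}"
    using cd deriv
    by (intro fundamental_theorem_of_calculus)
      (auto simp flip: has_real_derivative_iff_has_vector_derivative intro: has_field_derivative_at_within)
  from sign show ?thesis
  proof
    assume s: "\<forall>x\<in>{c..d}. 0 \<le> r' x"
    then have "0 \<le> r d - r c" using has_integral_nonneg[OF I] by auto
    then show ?thesis using I s by (subst has_integral_cong[where g = r']) auto
  next
    assume s: "\<forall>x\<in>{c..d}. r' x \<le> 0"
    have J: "((\<lambda>x. - r' x) has_integral - (r d - r c)) {c..d}" by (rule has_integral_neg[OF I])
    then have "0 \<le> - (r d - r c)" using has_integral_nonneg[OF J] s by auto
    then have "\<bar>r d - r c\<bar> = - (r d - r c)" by simp
    then show ?thesis using J s by (subst has_integral_cong[where g = "\<lambda>x. - r' x"]) auto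
  qed
qed

text \<open>Integration by parts after dividing by \<psi>'. Two boundary terms, the variation of
  \<open>s\<close> and the variation of 1 / \<psi>' each cost \<open>S * A / m\<close>, which makes
  up the \<open>4 * A\<close>; the derivative of \<open>w\<close> costs \<open>S * W / m\<close>.
  Monotonicity of \<open>s\<close> and of \<psi>' keeps the sizes of \<open>s'\<close> and \<psi>''
  out of the bound.\<close>

lemma nonstationary_phase_bound:
  fixes w w' :: "real \<Rightarrow> complex" and s s' \<psi> \<psi>' \<psi>'' :: "real \<Rightarrow> real"
  assumes cd: "c \<le> d" and t: "t > 0" and m: "m > 0"
    and d\<psi>: "\<And>x. x \<in> {c..d} \<Longrightarrow> (\<psi> has_real_derivative \<psi>' x) (at x)"
    and d\<psi>': "\<And>x. x \<in> {c..d} \<Longrightarrow> (\<psi>' has_real_derivative \<psi>'' x) (at x)"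
    and conv: "\<And>x. x \<in> {c..d} \<Longrightarrow> 0 \<le> \<psi>'' x"
    and lower: "(\<forall>x\<in>{c..d}. m \<le> \<psi>' x) \<or> (\<forall>x\<in>{c..d}. \<psi>' x \<le> - m)"
    and ds: "\<And>x. x \<in> {c..d} \<Longrightarrow> (s has_real_derivative s' x) (at x)"
    and sign: "(\<forall>x\<in>{c..d}. 0 \<le> s' x) \<or> (\<forall>x\<in>{c..d}. s' x \<le> 0)"
    and s: "\<And>x. x \<in> {c..d} \<Longrightarrow> 0 \<le> s x \<and> s x \<le> S"
    and dw: "\<And>x. x \<in> {c..d} \<Longrightarrow> (w has_vector_derivative w' x) (at x)"
    and w: "\<And>x. x \<in> {c..d} \<Longrightarrow> norm (w x) \<le> A"
    and W: "((\<lambda>x. norm (w' x)) has_integral W) {c..d}"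
  shows "norm (integral {c..d} (\<lambda>x. of_real (s x) * w x * exp (- \<i> * of_real (t * \<psi> x))))
           \<le> S * (4 * A + W) / (t * m)"
proof -
  define E where "E x = exp (- \<i> * of_real (t * \<psi> x))" for x
  define g where "g x = of_real (s x) * w x * E x" for x
  define h where "h x = of_real (s x / \<psi>' x) * w x * E x" for x
  define R where "R x = (of_real (s' x / \<psi>' x - s x * (\<psi>'' x / (\<psi>' x)^2)) * w x
      + of_real (s x / \<psi>' x) * w' x) * E x" for x
  \<comment> \<open>Pointwise majorant of \<open>R\<close>; each summand has an integral that is
    given or can be computed from endpoint values.\<close>
  define G where "G x = (A / m) * \<bar>s' x\<bar> + (S * A) * \<bar>- (\<psi>'' x / (\<psi>' x)^2)\<bar> + (S / m) * norm (w' x)" for x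
  have E1: "norm (E x) = 1" for x
    unfolding E_def by (metis norm_exp_i_times mult_minus_left mult_minus_right of_real_minus)
  have low: "m \<le> \<bar>\<psi>' x\<bar>" "\<psi>' x \<noteq> 0" if "x \<in> {c..d}" for x
    using lower m that by fastforce+
  have A0: "0 \<le> A" using w[of c] cd norm_ge_zero[of "w c"] by (simp add: order_trans del: norm_ge_zero)
  have S0: "0 \<le> S" using s[of c] cd by auto
  have dE: "(E has_vector_derivative - \<i> * of_real (t * \<psi>' x) * E x) (at x)" if "x \<in> {c..d}" for x
  proof -
    have "((\<lambda>x. t * \<psi> x) has_real_derivative t * \<psi>' x) (at x)"
      by (rule DERIV_cmult[OF d\<psi>[OF that]])
    then have "((\<lambda>x. - \<i> * of_real (t * \<psi> x)) has_vector_derivative - \<i> * of_real (t * \<psi>' x)) (at x)"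
      by (intro has_vector_derivative_mult_right has_vector_derivative_of_real)
         (simp add: has_real_derivative_iff_has_vector_derivative)
    from field_vector_diff_chain_at[OF this DERIV_exp]
    show ?thesis unfolding E_def o_def by (simp add: mult_ac)
  qed
  \<comment> \<open>Differentiating \<open>E\<close> brings down - \<i> t \<psi>', whose factor
    \<psi>' cancels the denominator of \<open>h\<close> and leaves \<open>g\<close>. The remaining
    terms of the product rule form \<open>R\<close>.\<close>
  have dh: "(h has_vector_derivative (R x - \<i> * of_real t * g x)) (at x)" if x: "x \<in> {c..d}" for x
  proof -
    have q: "((\<lambda>x. s x / \<psi>' x) has_real_derivative s' x / \<psi>' x - s x * (\<psi>'' x / (\<psi>' x)^2)) (at x)"
      using low[OF x] by (auto intro!: derivative_eq_intros ds[OF x] d\<psi>'[OF x] simp: field_simps power2_eq_square)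
    have "(h has_vector_derivative
        (of_real (s x / \<psi>' x) * w x) * (- \<i> * of_real (t * \<psi>' x) * E x)
        + (of_real (s x / \<psi>' x) * w' x + of_real (s' x / \<psi>' x - s x * (\<psi>'' x / (\<psi>' x)^2)) * w x) * E x) (at x)"
      unfolding h_def
      by (intro has_vector_derivative_mult dE[OF x] dw[OF x] has_vector_derivative_of_real q)
    also have "(of_real (s x / \<psi>' x) * w x) * (- \<i> * of_real (t * \<psi>' x) * E x) = - \<i> * of_real t * g x"
      using low[OF x] unfolding g_def by (simp add: field_simps)
    finally show ?thesis unfolding R_def by (simp add: algebra_simps)
  qed
  txt \<open>Only \<open>R x - \<i> t g x\<close> is known to be integrable a priori, being a derivative; \<open>w'\<close> need not be
    continuous. Integrability of \<open>R\<close> follows since \<open>g\<close> is continuous.\<close>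
  have Ih: "((\<lambda>x. R x - \<i> * of_real t * g x) has_integral (h d - h c)) {c..d}"
    by (rule fundamental_theorem_of_calculus[OF cd]) (rule has_vector_derivative_at_within[OF dh])
  have "continuous_on {c..d} g"
  proof (rule continuous_at_imp_continuous_on, rule ballI)
    fix x assume x: "x \<in> {c..d}"
    show "isCont g x"
      unfolding g_def
      by (intro continuous_intros DERIV_isCont[OF ds[OF x]] has_vector_derivative_continuous[OF dw[OF x]]
            has_vector_derivative_continuous[OF dE[OF x]])
  qed
  then have Ig: "(g has_integral integral {c..d} g) {c..d}"
    by (intro integrable_integral integrable_continuous_interval)
  from has_integral_add[OF Ih has_integral_mult_right[OF Ig, of "\<i> * of_real t"]]
  have IR: "(R has_integral (h d - h c + \<i> * of_real t * integral {c..d} g)) {c..d}"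
    by simp
  have var_s: "((\<lambda>x. \<bar>s' x\<bar>) has_integral \<bar>s d - s c\<bar>) {c..d}"
    by (rule has_integral_abs_derivative[OF cd ds sign])
  have var_q: "((\<lambda>x. \<bar>- (\<psi>'' x / (\<psi>' x)^2)\<bar>) has_integral \<bar>1 / \<psi>' d - 1 / \<psi>' c\<bar>) {c..d}"
  proof (rule has_integral_abs_derivative[OF cd])
    show "((\<lambda>x. 1 / \<psi>' x) has_real_derivative - (\<psi>'' x / (\<psi>' x)^2)) (at x)" if x: "x \<in> {c..d}" for x
      using low[OF x] by (auto intro!: derivative_eq_intros d\<psi>'[OF x] simp: field_simps power2_eq_square)
    show "(\<forall>x\<in>{c..d}. 0 \<le> - (\<psi>'' x / (\<psi>' x)\<^sup>2)) \<or> (\<forall>x\<in>{c..d}. - (\<psi>'' x / (\<psi>' x)\<^sup>2) \<le> 0)"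
      using conv by auto
  qed
  have IG: "(G has_integral (A / m) * \<bar>s d - s c\<bar> + (S * A) * \<bar>1 / \<psi>' d - 1 / \<psi>' c\<bar> + (S / m) * W) {c..d}"
    unfolding G_def by (intro has_integral_add has_integral_mult_right var_s var_q W)
  have RG: "norm (R x) \<le> G x" if x: "x \<in> {c..d}" for x
  proof -
    have "norm (R x) \<le> norm (of_real (s' x / \<psi>' x) * w x) + norm (of_real (s x * (\<psi>'' x / (\<psi>' x)^2)) * w x)
        + norm (of_real (s x / \<psi>' x) * w' x)"
      unfolding R_def norm_mult[of _ "E x"] E1 of_real_diff left_diff_distrib mult_1_right
      by (intro norm_triangle_le add_mono norm_triangle_ineq4 order_refl)
    also have "norm (of_real (s' x / \<psi>' x) * w x) \<le> (A / m) * \<bar>s' x\<bar>"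
    proof -
      have "\<bar>s' x\<bar> / \<bar>\<psi>' x\<bar> * norm (w x) \<le> \<bar>s' x\<bar> / m * A"
        using low[OF x] m w[OF x] by (intro mult_mono divide_left_mono) auto
      then show ?thesis by (simp add: norm_mult norm_divide mult_ac)
    qed
    also have "norm (of_real (s x * (\<psi>'' x / (\<psi>' x)^2)) * w x) \<le> (S * A) * \<bar>- (\<psi>'' x / (\<psi>' x)^2)\<bar>"
    proof -
      have "\<bar>s x\<bar> * \<bar>\<psi>'' x / (\<psi>' x)^2\<bar> * norm (w x) \<le> S * \<bar>\<psi>'' x / (\<psi>' x)^2\<bar> * A"
        using s[OF x] w[OF x] by (intro mult_mono) auto
      then show ?thesis by (simp only: norm_mult norm_of_real abs_mult abs_minus_cancel mult_ac)
    qed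
    also have "norm (of_real (s x / \<psi>' x) * w' x) \<le> (S / m) * norm (w' x)"
    proof -
      have "\<bar>s x\<bar> / \<bar>\<psi>' x\<bar> * norm (w' x) \<le> S / m * norm (w' x)"
        using low[OF x] m s[OF x] by (intro mult_mono frac_le) auto
      then show ?thesis by (simp add: norm_mult norm_divide)
    qed
    finally show ?thesis unfolding G_def by simp
  qed
  have "norm (h d - h c + \<i> * of_real t * integral {c..d} g)
      \<le> (A / m) * \<bar>s d - s c\<bar> + (S * A) * \<bar>1 / \<psi>' d - 1 / \<psi>' c\<bar> + (S / m) * W"
    using integral_norm_bound_integral[of R "{c..d}" G] IR IG RG
    by (metis has_integral_integrable_integral)
  also have "\<dots> \<le> (A / m) * S + (S * A) * (1 / m) + (S / m) * W"
  proof -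
    have "\<bar>s d - s c\<bar> \<le> S" using s[of c] s[of d] cd by auto
    moreover have "\<bar>1 / \<psi>' d - 1 / \<psi>' c\<bar> \<le> 1 / m"
    proof -
      \<comment> \<open>Both reciprocals lie between 0 and \<open>1 / m\<close>, so they differ by
        at most \<open>1 / m\<close> and not merely \<open>2 / m\<close>. This is where the constant
        sign of \<psi>' enters the constant.\<close>
      have k: "\<bar>1 / y - 1 / z\<bar> \<le> 1 / m" if "m \<le> y" "m \<le> z" for y z
      proof -
        have "0 < 1 / y" "1 / y \<le> 1 / m" "0 < 1 / z" "1 / z \<le> 1 / m"
          using m that by (auto intro!: divide_left_mono)
        then show ?thesis by linarith
      qed
      from lower show ?thesis
      proof
        assume "\<forall>x\<in>{c..d}. m \<le> \<psi>' x"
        then show ?thesis using cd by (intro k) auto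
      next
        assume "\<forall>x\<in>{c..d}. \<psi>' x \<le> - m"
        then have "\<psi>' c \<le> - m" "\<psi>' d \<le> - m" using cd by auto
        then have "m \<le> - \<psi>' c" "m \<le> - \<psi>' d" by linarith+
        then have "\<bar>1 / (- \<psi>' c) - 1 / (- \<psi>' d)\<bar> \<le> 1 / m" by (rule k)
        then show ?thesis by simp
      qed
    qed
    ultimately show ?thesis using A0 S0 m
      by (intro add_mono mult_left_mono order_refl) auto
  qed
  finally have main: "norm (h d - h c + \<i> * of_real t * integral {c..d} g) \<le> S * (2 * A + W) / m"
    by (simp add: algebra_simps add_divide_distrib)
  have hb: "norm (h x) \<le> S * A / m" if x: "x \<in> {c..d}" for x
  proof -
    have "\<bar>s x\<bar> / \<bar>\<psi>' x\<bar> * norm (w x) \<le> S / m * A"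
      using low[OF x] m s[OF x] w[OF x] by (intro mult_mono frac_le) auto
    then show ?thesis unfolding h_def by (simp add: norm_mult norm_divide E1)
  qed
  \<comment> \<open>Solving the integrated identity for the integral of \<open>g\<close>: each
    endpoint value of \<open>h\<close> adds \<open>S * A / m\<close>, raising \<open>2 * A\<close>
    to \<open>4 * A\<close>.\<close>
  have "\<i> * of_real t * integral {c..d} g = (h d - h c + \<i> * of_real t * integral {c..d} g) - h d + h c"
    by simp
  also have "norm \<dots> \<le> S * (2 * A + W) / m + S * A / m + S * A / m"
  proof -
    have "norm (x - y + z) \<le> norm x + norm y + norm z" for x y z :: complex
      using norm_triangle_ineq[of "x - y" z] norm_triangle_ineq4[of x y] by linarith
    also have "norm (h d - h c + \<i> * of_real t * integral {c..d} g) + norm (h d) + norm (h c)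
        \<le> S * (2 * A + W) / m + S * A / m + S * A / m"
      using cd by (intro add_mono main hb) auto
    finally show ?thesis .
  qed
  finally have "t * norm (integral {c..d} g) \<le> S * (4 * A + W) / m"
    using t by (simp add: norm_mult algebra_simps add_divide_distrib)
  then show ?thesis using t m unfolding g_def E_def by (simp add: field_simps)
qed

section \<open>Essential supremum and integrals over the whole line\<close>

text \<open>For continuous \<open>w\<close> the set where the norm is at most the essential supremum
  is closed. It has full measure, hence is the whole line, so the almost everywhere bound holds at
  every point.\<close>

lemma norm_le_Linf_norm:
  fixes w :: "real \<Rightarrow> complex"
  assumes cont: "continuous_on UNIV w" and bdd: "bounded (range w)"
  shows "norm (w p) \<le> Linf_norm w"
proof -
  define e where "e = esssup lborel (\<lambda>p. ereal (norm (w p)))"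
  have [measurable]: "w \<in> borel_measurable borel" using cont by (rule borel_measurable_continuous_onI)
  obtain K where K: "\<And>p. norm (w p) \<le> K" using bdd by (auto simp: bounded_iff)
  have le: "e \<le> ereal K" unfolding e_def by (rule esssup_I) (auto simp: K)
  have "AE p in lborel. ereal (norm (w p)) \<le> e" unfolding e_def by (rule esssup_AE)
  then have "AE p in lebesgue. p \<in> {p. ereal (norm (w p)) \<le> e}" by (simp add: AE_completion)
  moreover have "closed {p. ereal (norm (w p)) \<le> e}"
    by (intro closed_Collect_le continuous_intros cont)
  ultimately have ge: "ereal (norm (w p)) \<le> e" for p
    using mem_closed_if_AE_lebesgue by blast
  \<comment> \<open>\<open>real_of_ereal\<close> sends both infinities to 0, so finiteness has to be
    secured first: boundedness of \<open>w\<close> excludes one, any value of the norm the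
    other.\<close>
  have "e \<noteq> - \<infinity>" "e \<noteq> \<infinity>" using ge[of 0] le by auto
  then show ?thesis using ge[of p] unfolding Linf_norm_def e_def[symmetric] by (cases e) auto
qed

text \<open>The integral over the line is the limit of those over symmetric intervals, so a bound
  uniform in large \<open>N\<close> survives. Estimates on compact intervals thereby reach the
  unbounded zones.\<close>

lemma norm_integral_UNIV_le:
  fixes F :: "real \<Rightarrow> 'a::euclidean_space"
  assumes F: "F integrable_on UNIV"
    and le: "\<And>N. N \<ge> N0 \<Longrightarrow> norm (integral {-N..N} F) \<le> K"
  shows "norm (integral UNIV F) \<le> K"
proof (rule field_le_epsilon)
  fix e :: real assume "e > 0"
  with integrable_integral[OF F] obtain r where r: "r > 0"
    "\<And>a b. ball 0 r \<subseteq> cbox a b \<Longrightarrow> norm (integral (cbox a b) F - integral UNIV F) < e"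
    unfolding has_integral_alt'[of F] by auto
  define N where "N = max N0 r"
  have "norm (integral {-N..N} F - integral UNIV F) < e"
  proof -
    have "ball 0 r \<subseteq> cbox (-N) N" by (auto simp: N_def)
    then show ?thesis using r(2)[of "-N" N] by simp
  qed
  moreover have "norm (integral {-N..N} F) \<le> K" by (rule le) (simp add: N_def)
  ultimately show "norm (integral UNIV F) \<le> K + e"
    using norm_triangle_sub[of "integral UNIV F" "integral {-N..N} F"]
    by (simp add: norm_minus_commute)
qed

section \<open>Integrals of the singular weight\<close>

text \<open>The primitive is continuous up to \<open>q\<close> because \<mu> > 0, but for \<mu> < 1
  it is not differentiable there; hence the form of the fundamental theorem that asks for the
  derivative only in the interior.\<close>

lemma has_integral_powr_left:
  assumes "q \<le> d" "0 < \<mu>"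
  shows "((\<lambda>x::real. \<bar>x - q\<bar> powr (\<mu> - 1)) has_integral (d - q) powr \<mu> / \<mu>) {q..d}"
proof -
  have "((\<lambda>x. \<bar>x - q\<bar> powr (\<mu> - 1)) has_integral ((d - q) powr \<mu> / \<mu> - (q - q) powr \<mu> / \<mu>)) {q..d}"
  proof (rule fundamental_theorem_of_calculus_interior)
    show "continuous_on {q..d} (\<lambda>x. (x - q) powr \<mu> / \<mu>)"
      using assms by (intro continuous_on_divide continuous_on_powr' continuous_intros) auto
    show "((\<lambda>x. (x - q) powr \<mu> / \<mu>) has_vector_derivative \<bar>x - q\<bar> powr (\<mu> - 1)) (at x)"
      if "x \<in> {q<..<d}" for x
      using that assms
      by (auto intro!: derivative_eq_intros simp flip: has_real_derivative_iff_has_vector_derivative)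
  qed (use assms in auto)
  then show ?thesis by simp
qed

lemma has_integral_powr_right:
  assumes "c \<le> q" "0 < \<mu>"
  shows "((\<lambda>x::real. \<bar>x - q\<bar> powr (\<mu> - 1)) has_integral (q - c) powr \<mu> / \<mu>) {c..q}"
proof -
  have "((\<lambda>x. \<bar>x - q\<bar> powr (\<mu> - 1)) has_integral (- ((q - q) powr \<mu> / \<mu>) - - ((q - c) powr \<mu> / \<mu>))) {c..q}"
  proof (rule fundamental_theorem_of_calculus_interior)
    show "continuous_on {c..q} (\<lambda>x. - ((q - x) powr \<mu> / \<mu>))"
      using assms by (intro continuous_on_minus continuous_on_divide continuous_on_powr' continuous_intros) auto
    show "((\<lambda>x. - ((q - x) powr \<mu> / \<mu>)) has_vector_derivative \<bar>x - q\<bar> powr (\<mu> - 1)) (at x)"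
      if "x \<in> {c<..<q}" for x
      using that assms
      by (auto intro!: derivative_eq_intros simp flip: has_real_derivative_iff_has_vector_derivative)
  qed (use assms in auto)
  then show ?thesis by simp
qed

section \<open>Zone estimates for the oscillatory integral with singular weight\<close>

text \<open>Time and velocity are frozen, the velocity being absorbed into the phase.
  \<open>F_int\<close> is integrability in the Henstock-Kurzweil sense, which allows cutting the
  line at arbitrary points.\<close>

locale singular_oscillatory_integral =
  fixes w w' :: "real \<Rightarrow> complex" and \<psi> \<psi>' \<psi>'' :: "real \<Rightarrow> real" and \<mu> q t A :: real
  assumes t: "t > 0" and mu: "0 < \<mu>" "\<mu> \<le> 1"
    and d\<psi>: "\<And>x. (\<psi> has_real_derivative \<psi>' x) (at x)"
    and d\<psi>': "\<And>x. (\<psi>' has_real_derivative \<psi>'' x) (at x)"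
    and conv: "\<And>x. 0 \<le> \<psi>'' x"
    and dw: "\<And>x. (w has_vector_derivative w' x) (at x)"
    and w: "\<And>x. norm (w x) \<le> A"
    and w'_int: "(\<lambda>x. norm (w' x)) integrable_on UNIV"
    and F_int: "(\<lambda>x. of_real (\<bar>x - q\<bar> powr (\<mu> - 1)) * w x * exp (- \<i> * of_real (t * \<psi> x)))
                  integrable_on UNIV"
begin

text \<open>At \<open>x = q\<close> the value is 0, even for \<mu> = 1, because
  \<open>0 powr r = 0\<close> for every \<open>r\<close>; a single point does not affect the
  integrals.\<close>

definition F where
  "F x = of_real (\<bar>x - q\<bar> powr (\<mu> - 1)) * w x * exp (- \<i> * of_real (t * \<psi> x))"

text \<open>The integral runs over the whole line, so that one constant serves every zone.\<close>

definition B where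
  "B = 4 * A + integral UNIV (\<lambda>x. norm (w' x))"

text \<open>The disjunction stands outside the quantifiers so that \<psi>' keeps one sign on all of
  \<open>I\<close>.\<close>

definition separated where
  "separated m I \<longleftrightarrow> (\<forall>x\<in>I. m \<le> \<psi>' x) \<or> (\<forall>x\<in>I. \<psi>' x \<le> - m)"

lemma separated_subset: "separated m I \<Longrightarrow> J \<subseteq> I \<Longrightarrow> separated m J"
  unfolding separated_def by blast

lemma F_integrable: "F integrable_on {c..d}"
  using integrable_on_subcbox[OF F_int, of c d] by (simp add: F_def[abs_def])

lemma integral_F_split: "c \<le> r \<Longrightarrow> r \<le> d \<Longrightarrow> integral {c..d} F = integral {c..r} F + integral {r..d} F"
  using Henstock_Kurzweil_Integration.integral_combine[OF _ _ F_integrable] by simp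

lemma A_nonneg: "0 \<le> A"
  using w[of 0] norm_ge_zero order_trans by blast

lemma B_nonneg: "0 \<le> B"
  unfolding B_def using A_nonneg w'_int by (auto intro!: add_nonneg_nonneg integral_nonneg)

lemma norm_F: "norm (F x) \<le> \<bar>x - q\<bar> powr (\<mu> - 1) * A"
proof -
  have "norm (exp (- \<i> * of_real (t * \<psi> x))) = 1"
    by (metis norm_exp_i_times mult_minus_left mult_minus_right of_real_minus)
  then show ?thesis unfolding F_def by (simp add: norm_mult mult_left_mono w)
qed

text \<open>Away from \<open>q\<close> the weight is smooth, and since \<mu> \<le> 1 it is monotone
  on either side, with its maximum at the endpoint nearest to \<open>q\<close>. Bounding it at both
  endpoints covers both sides at once.\<close>

lemma nonstationary_zone:
  assumes cd: "c \<le> d" and m: "0 < m" and sep: "separated m {c..d}" and q: "q \<notin> {c..d}"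
    and S: "\<bar>c - q\<bar> powr (\<mu> - 1) \<le> S" "\<bar>d - q\<bar> powr (\<mu> - 1) \<le> S"
  shows "norm (integral {c..d} F) \<le> S * B / (t * m)"
proof -
  have int: "(\<lambda>x. norm (w' x)) integrable_on {c..d}"
    using integrable_on_subcbox[OF w'_int, of c d] by simp
  then have W: "((\<lambda>x. norm (w' x)) has_integral integral {c..d} (\<lambda>x. norm (w' x))) {c..d}"
    by (rule integrable_integral)
  have Wle: "integral {c..d} (\<lambda>x. norm (w' x)) \<le> integral UNIV (\<lambda>x. norm (w' x))"
    by (rule integral_subset_le) (use int w'_int in auto)
  have S0: "0 \<le> S" using S(1) powr_ge_zero order_trans by blast
  note bound = nonstationary_phase_bound[OF cd t m d\<psi> d\<psi>' conv sep[unfolded separated_def] _ _ _ dw w W]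
  have "norm (integral {c..d} F) \<le> S * (4 * A + integral {c..d} (\<lambda>x. norm (w' x))) / (t * m)"
  proof (cases "q < c")
    case True
    let ?s = "\<lambda>x. (x - q) powr (\<mu> - 1)"
    have "norm (integral {c..d} (\<lambda>x. of_real (?s x) * w x * exp (- \<i> * of_real (t * \<psi> x))))
        \<le> S * (4 * A + integral {c..d} (\<lambda>x. norm (w' x))) / (t * m)"
    proof (rule bound)
      show "(?s has_real_derivative (\<mu> - 1) * (x - q) powr (\<mu> - 1 - 1)) (at x)" if "x \<in> {c..d}" for x
        using that True by (auto intro!: derivative_eq_intros)
      show "(\<forall>x\<in>{c..d}. 0 \<le> (\<mu> - 1) * (x - q) powr (\<mu> - 1 - 1)) \<or>
          (\<forall>x\<in>{c..d}. (\<mu> - 1) * (x - q) powr (\<mu> - 1 - 1) \<le> 0)"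
        using mu by (auto intro!: mult_nonpos_nonneg)
      show "0 \<le> ?s x \<and> ?s x \<le> S" if "x \<in> {c..d}" for x
        using powr_mono2'[of "\<mu> - 1" "c - q" "x - q"] that True mu S(1) by auto
    qed
    moreover have "integral {c..d} (\<lambda>x. of_real (?s x) * w x * exp (- \<i> * of_real (t * \<psi> x))) = integral {c..d} F"
      by (rule Henstock_Kurzweil_Integration.integral_cong) (use True in \<open>auto simp: F_def\<close>)
    ultimately show ?thesis by simp
  next
    case False
    then have qd: "d < q" using q by auto
    let ?s = "\<lambda>x. (q - x) powr (\<mu> - 1)"
    have "norm (integral {c..d} (\<lambda>x. of_real (?s x) * w x * exp (- \<i> * of_real (t * \<psi> x))))
        \<le> S * (4 * A + integral {c..d} (\<lambda>x. norm (w' x))) / (t * m)"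
    proof (rule bound)
      show "(?s has_real_derivative - (\<mu> - 1) * (q - x) powr (\<mu> - 1 - 1)) (at x)" if "x \<in> {c..d}" for x
        using that qd by (auto intro!: derivative_eq_intros simp: algebra_simps)
      show "(\<forall>x\<in>{c..d}. 0 \<le> - (\<mu> - 1) * (q - x) powr (\<mu> - 1 - 1)) \<or>
          (\<forall>x\<in>{c..d}. - (\<mu> - 1) * (q - x) powr (\<mu> - 1 - 1) \<le> 0)"
        using mu by (auto intro!: mult_nonneg_nonneg)
      show "0 \<le> ?s x \<and> ?s x \<le> S" if "x \<in> {c..d}" for x
        using powr_mono2'[of "\<mu> - 1" "q - d" "q - x"] that qd mu S(2) by auto
    qed
    moreover have "integral {c..d} (\<lambda>x. of_real (?s x) * w x * exp (- \<i> * of_real (t * \<psi> x))) = integral {c..d} F"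
      by (rule Henstock_Kurzweil_Integration.integral_cong) (use qd in \<open>auto simp: F_def\<close>)
    ultimately show ?thesis by simp
  qed
  also have "\<dots> \<le> S * B / (t * m)"
    unfolding B_def using Wle S0 t m by (intro divide_right_mono mult_left_mono) auto
  finally show ?thesis .
qed

text \<open>The trivial estimate: the weight is integrable across \<open>q\<close>, with mass at
  most \<delta> powr \<mu> / \<mu> on each side.\<close>

lemma singular_neighbourhood:
  assumes c: "c \<le> q" "q - c \<le> \<delta>" and d: "q \<le> d" "d - q \<le> \<delta>"
  shows "norm (integral {c..d} F) \<le> 2 * A * \<delta> powr \<mu> / \<mu>"
proof -
  have "((\<lambda>x. \<bar>x - q\<bar> powr (\<mu> - 1)) has_integral (q - c) powr \<mu> / \<mu> + (d - q) powr \<mu> / \<mu>) {c..d}"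
    using c d mu by (intro has_integral_combine[of c q d] has_integral_powr_left has_integral_powr_right)
  from has_integral_mult_left[OF this, of A]
  have "norm (integral {c..d} F) \<le> ((q - c) powr \<mu> / \<mu> + (d - q) powr \<mu> / \<mu>) * A"
    using integral_norm_bound_integral[OF F_integrable] norm_F
    by (metis (no_types, lifting) has_integral_integrable_integral)
  also have "\<dots> \<le> (\<delta> powr \<mu> / \<mu> + \<delta> powr \<mu> / \<mu>) * A"
    using c d mu A_nonneg by (intro mult_right_mono add_mono divide_right_mono powr_mono2) auto
  finally show ?thesis by (simp add: field_simps)
qed

text \<open>The two outer pieces contribute S * B / m * \<delta> each and the middle one 2 *
  \<delta> * (S * A), which add up to the stated constant.\<close>

lemma stationary_zone:
  assumes p0: "p0 \<in> {c..d}" "\<psi>' p0 = 0" and m: "0 < m" "\<And>x. x \<in> {c..d} \<Longrightarrow> m \<le> \<psi>'' x"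
    and q: "q \<notin> {c..d}" and S: "\<And>x. x \<in> {c..d} \<Longrightarrow> \<bar>x - q\<bar> powr (\<mu> - 1) \<le> S"
  shows "norm (integral {c..d} F) \<le> 2 * S * (A + B / m) * t powr (- 1 / 2)"
proof -
  define \<delta> where "\<delta> = t powr (- 1 / 2)"
  have \<delta>: "\<delta> > 0" using t by (simp add: \<delta>_def)
  have "\<delta> * \<delta> = t powr (-1)" unfolding \<delta>_def by (simp flip: powr_add)
  then have td: "t * \<delta> * \<delta> = 1" using t by (simp add: powr_minus field_simps)
  \<comment> \<open>For small \<open>t\<close> the radius \<delta> may exceed the zone. The cut is
    then clipped to the endpoint, the outer piece shrinks to a point, and its bound holds because
    the right-hand side is nonnegative.\<close>
  define c' where "c' = max c (p0 - \<delta>)"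
  define d' where "d' = min d (p0 + \<delta>)"
  have ord: "c \<le> c'" "c' \<le> p0" "p0 \<le> d'" "d' \<le> d" using p0 \<delta> by (auto simp: c'_def d'_def)
  have S0: "0 \<le> S" using S[OF p0(1)] powr_ge_zero order_trans by blast
  \<comment> \<open>As t * \<delta> * \<delta> = 1, the gain 1 / (t * \<delta>) equals \<delta>, the
    length scale of the middle piece.\<close>
  have SB: "S * B / (t * (m * \<delta>)) = S * B / m * \<delta>"
    using td t m \<delta> by (simp add: field_simps)
  have nn: "0 \<le> S * B / m * \<delta>" using S0 B_nonneg m \<delta> by simp
  \<comment> \<open>By the mean value theorem \<psi>' grows at rate at least \<open>m\<close>, so it
    is at least m * \<delta> in absolute value at distance \<delta> or more from its zero
    \<open>p0\<close>.\<close>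
  have grow: "m * (y - x) \<le> \<psi>' y - \<psi>' x" if "x \<le> y" "x \<in> {c..d}" "y \<in> {c..d}" for x y
  proof (cases "x = y")
    case False
    then have "x < y" using that by simp
    from MVT2[OF this d\<psi>'] obtain z where z: "x < z" "z < y" "\<psi>' y - \<psi>' x = (y - x) * \<psi>'' z"
      by blast
    have "(y - x) * m \<le> (y - x) * \<psi>'' z" using z that by (intro mult_left_mono m(2)) auto
    then show ?thesis using z by (simp add: mult.commute)
  qed simp
  have left: "norm (integral {c..c'} F) \<le> S * B / m * \<delta>"
  proof (cases "c = c'")
    case False
    then have c': "c' = p0 - \<delta>" by (auto simp: c'_def)
    have "\<psi>' x \<le> - (m * \<delta>)" if "x \<in> {c..c'}" for x
    proof -
      have "m * \<delta> \<le> m * (p0 - x)" using that c' m by auto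
      then show ?thesis using grow[of x p0] that p0 ord by auto
    qed
    then have "separated (m * \<delta>) {c..c'}" by (auto simp: separated_def)
    then have "norm (integral {c..c'} F) \<le> S * B / (t * (m * \<delta>))"
      using ord q m \<delta> by (intro nonstationary_zone S) auto
    then show ?thesis by (simp add: SB)
  qed (use nn in simp)
  have right: "norm (integral {d'..d} F) \<le> S * B / m * \<delta>"
  proof (cases "d = d'")
    case False
    then have d': "d' = p0 + \<delta>" by (auto simp: d'_def)
    have "m * \<delta> \<le> \<psi>' x" if "x \<in> {d'..d}" for x
    proof -
      have "m * \<delta> \<le> m * (x - p0)" using that d' m by auto
      then show ?thesis using grow[of p0 x] that p0 ord by auto
    qed
    then have "separated (m * \<delta>) {d'..d}" by (auto simp: separated_def)
    then have "norm (integral {d'..d} F) \<le> S * B / (t * (m * \<delta>))"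
      using ord q m \<delta> by (intro nonstationary_zone S) auto
    then show ?thesis by (simp add: SB)
  qed (use nn in simp)
  have "norm (integral {c'..d'} F) \<le> integral {c'..d'} (\<lambda>_. S * A)"
  proof (rule integral_norm_bound_integral[OF F_integrable])
    show "norm (F x) \<le> S * A" if "x \<in> {c'..d'}" for x
      using norm_F[of x] mult_right_mono[OF S A_nonneg, of x] that ord by auto
  qed auto
  also have "\<dots> = (d' - c') * (S * A)" using ord by simp
  also have "\<dots> \<le> (2 * \<delta>) * (S * A)"
    using S0 A_nonneg by (intro mult_right_mono) (auto simp: c'_def d'_def)
  finally have "norm (integral {c'..d'} F) \<le> 2 * \<delta> * (S * A)" .
  moreover have decomp: "integral {c..d} F = integral {c..c'} F + (integral {c'..d'} F + integral {d'..d} F)"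
    using integral_F_split[of c c' d] integral_F_split[of c' d' d] ord by simp
  ultimately have "norm (integral {c..d} F) \<le> S * B / m * \<delta> + (2 * \<delta> * (S * A) + S * B / m * \<delta>)"
    unfolding decomp by (intro norm_triangle_le add_mono left right)
  then show ?thesis unfolding \<delta>_def[symmetric] by (simp add: algebra_simps)
qed

text \<open>Here the separation \<open>m\<close> holds on the whole zone and does not shrink with
  \<delta>; only the weight deteriorates near \<open>q\<close>. With \<delta> = 1 / t, its size
  \<delta> powr (\<mu> - 1) times the gain 1 / t is again \<delta> powr \<mu>, the order of the
  trivial estimate.\<close>

lemma singular_zone:
  assumes q: "q \<in> {c..d}" and m: "0 < m" and sep: "separated m {c..d}"
  shows "norm (integral {c..d} F) \<le> 2 * (A / \<mu> + B / m) * t powr (- \<mu>)"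
proof -
  define \<delta> where "\<delta> = 1 / t"
  have \<delta>: "\<delta> > 0" using t by (simp add: \<delta>_def)
  have d\<mu>: "\<delta> powr \<mu> = t powr (- \<mu>)" using t by (simp add: \<delta>_def powr_divide powr_minus_divide)
  have SB: "\<delta> powr (\<mu> - 1) * B / (t * m) = B / m * t powr (- \<mu>)"
    unfolding d\<mu>[symmetric] using t m by (simp add: powr_diff) (simp add: \<delta>_def)
  have nn: "0 \<le> B / m * t powr (- \<mu>)" using B_nonneg m by simp
  define c' where "c' = max c (q - \<delta>)"
  define d' where "d' = min d (q + \<delta>)"
  have ord: "c \<le> c'" "c' \<le> q" "q \<le> d'" "d' \<le> d" using q \<delta> by (auto simp: c'_def d'_def)
  have S: "\<bar>x - q\<bar> powr (\<mu> - 1) \<le> \<delta> powr (\<mu> - 1)" if "\<delta> \<le> \<bar>x - q\<bar>" for x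
    using that \<delta> mu by (intro powr_mono2') auto
  have left: "norm (integral {c..c'} F) \<le> B / m * t powr (- \<mu>)"
  proof (cases "c = c'")
    case False
    then have "c' = q - \<delta>" by (auto simp: c'_def)
    then have "norm (integral {c..c'} F) \<le> \<delta> powr (\<mu> - 1) * B / (t * m)"
      using ord \<delta> m by (intro nonstationary_zone S separated_subset[OF sep]) auto
    then show ?thesis by (simp add: SB)
  qed (use nn in simp)
  have right: "norm (integral {d'..d} F) \<le> B / m * t powr (- \<mu>)"
  proof (cases "d = d'")
    case False
    then have "d' = q + \<delta>" by (auto simp: d'_def)
    then have "norm (integral {d'..d} F) \<le> \<delta> powr (\<mu> - 1) * B / (t * m)"
      using ord \<delta> m by (intro nonstationary_zone S separated_subset[OF sep]) auto
    then show ?thesis by (simp add: SB)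
  qed (use nn in simp)
  have "norm (integral {c'..d'} F) \<le> 2 * A * \<delta> powr \<mu> / \<mu>"
    using ord by (intro singular_neighbourhood) (auto simp: c'_def d'_def)
  moreover have decomp: "integral {c..d} F = integral {c..c'} F + (integral {c'..d'} F + integral {d'..d} F)"
    using integral_F_split[of c c' d] integral_F_split[of c' d' d] ord by simp
  ultimately have "norm (integral {c..d} F)
      \<le> B / m * t powr (- \<mu>) + (2 * A * \<delta> powr \<mu> / \<mu> + B / m * t powr (- \<mu>))"
    unfolding decomp by (intro norm_triangle_le add_mono left right)
  then show ?thesis unfolding d\<mu> by (simp add: algebra_simps)
qed

section \<open>Assembling the three zones\<close>

lemma mono_\<psi>': "x \<le> y \<Longrightarrow> \<psi>' x \<le> \<psi>' y"
  using DERIV_nonneg_imp_nondecreasing[of x y \<psi>'] d\<psi>' conv by blast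

text \<open>By monotonicity of \<psi>' its bounds at \<open>c\<close> and \<open>d\<close> extend to
  the half-lines beyond. With \<open>q\<close> to the left, the weight on the other two zones is
  largest at their left ends \<open>c\<close> and \<open>d\<close>. None of the three estimates
  depends on \<open>N\<close>.\<close>

lemma integral_bound_singularity_left:
  assumes q: "q < c" and cd: "c \<le> d" and p0: "p0 \<in> {c..d}" "\<psi>' p0 = 0"
    and m: "0 < m" "\<And>x. x \<in> {c..d} \<Longrightarrow> m \<le> \<psi>'' x"
    and m2: "0 < m2" "\<psi>' c \<le> - m2" and m3: "0 < m3" "m3 \<le> \<psi>' d"
  shows "norm (integral UNIV F) \<le> 2 * (c - q) powr (\<mu> - 1) * (A + B / m) * t powr (- 1 / 2)
    + 2 * (A / \<mu> + B / m2) * t powr (- \<mu>) + (d - q) powr (\<mu> - 1) * B / (t * m3)"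
proof (rule norm_integral_UNIV_le)
  show "F integrable_on UNIV" using F_int by (simp add: F_def[abs_def])
next
  \<comment> \<open>The threshold places \<open>q\<close>, \<open>c\<close> and \<open>d\<close>
    inside \<open>{-N..N}\<close>.\<close>
  fix N assume "\<bar>q\<bar> + \<bar>c\<bar> + \<bar>d\<bar> \<le> N"
  then have N: "- N \<le> q" "d \<le> N" "-N \<le> c" by auto
  have "norm (integral {-N..c} F) \<le> 2 * (A / \<mu> + B / m2) * t powr (- \<mu>)"
    by (rule singular_zone) (use q N m2 mono_\<psi>' in \<open>force simp: separated_def\<close>)+
  moreover have "norm (integral {c..d} F) \<le> 2 * (c - q) powr (\<mu> - 1) * (A + B / m) * t powr (- 1 / 2)"
    by (rule stationary_zone[OF p0 m]) (use q mu in \<open>auto intro!: powr_mono2'\<close>)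
  moreover have "norm (integral {d..N} F) \<le> (d - q) powr (\<mu> - 1) * B / (t * m3)"
    by (rule nonstationary_zone)
      (use q cd N m3 mono_\<psi>' mu in \<open>force simp: separated_def intro!: powr_mono2'\<close>)+
  \<comment> \<open>The summands are grouped in the order of the terms of the bound, so that the
    triangle inequality matches them one by one.\<close>
  moreover have decomp: "integral {-N..N} F = (integral {c..d} F + integral {-N..c} F) + integral {d..N} F"
    using integral_F_split[of "-N" c N] integral_F_split[of c d N] cd N by simp
  ultimately show "norm (integral {-N..N} F) \<le> 2 * (c - q) powr (\<mu> - 1) * (A + B / m) * t powr (- 1 / 2)
      + 2 * (A / \<mu> + B / m2) * t powr (- \<mu>) + (d - q) powr (\<mu> - 1) * B / (t * m3)"
    unfolding decomp by (intro norm_triangle_le add_mono)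
qed

text \<open>The reflected situation: the singular zone is now the right half-line, so
  \<open>m3\<close> enters the term in t powr (- \<mu>) and \<open>m2\<close> the term in 1 /
  t.\<close>

lemma integral_bound_singularity_right:
  assumes q: "d < q" and cd: "c \<le> d" and p0: "p0 \<in> {c..d}" "\<psi>' p0 = 0"
    and m: "0 < m" "\<And>x. x \<in> {c..d} \<Longrightarrow> m \<le> \<psi>'' x"
    and m2: "0 < m2" "\<psi>' c \<le> - m2" and m3: "0 < m3" "m3 \<le> \<psi>' d"
  shows "norm (integral UNIV F) \<le> 2 * (q - d) powr (\<mu> - 1) * (A + B / m) * t powr (- 1 / 2)
    + 2 * (A / \<mu> + B / m3) * t powr (- \<mu>) + (q - c) powr (\<mu> - 1) * B / (t * m2)"
proof (rule norm_integral_UNIV_le)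
  show "F integrable_on UNIV" using F_int by (simp add: F_def[abs_def])
next
  fix N assume "\<bar>q\<bar> + \<bar>c\<bar> + \<bar>d\<bar> \<le> N"
  then have N: "q \<le> N" "d \<le> N" "-N \<le> c" by auto
  have "norm (integral {d..N} F) \<le> 2 * (A / \<mu> + B / m3) * t powr (- \<mu>)"
    by (rule singular_zone) (use q N m3 mono_\<psi>' in \<open>force simp: separated_def\<close>)+
  moreover have "norm (integral {c..d} F) \<le> 2 * (q - d) powr (\<mu> - 1) * (A + B / m) * t powr (- 1 / 2)"
    by (rule stationary_zone[OF p0 m]) (use q mu in \<open>auto intro!: powr_mono2'\<close>)
  moreover have "norm (integral {-N..c} F) \<le> (q - c) powr (\<mu> - 1) * B / (t * m2)"
    by (rule nonstationary_zone)
      (use q cd N m2 mono_\<psi>' mu in \<open>force simp: separated_def intro!: powr_mono2'\<close>)+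
  moreover have decomp: "integral {-N..N} F = (integral {c..d} F + integral {d..N} F) + integral {-N..c} F"
    using integral_F_split[of "-N" c N] integral_F_split[of c d N] cd N by simp
  ultimately show "norm (integral {-N..N} F) \<le> 2 * (q - d) powr (\<mu> - 1) * (A + B / m) * t powr (- 1 / 2)
      + 2 * (A / \<mu> + B / m3) * t powr (- \<mu>) + (q - c) powr (\<mu> - 1) * B / (t * m2)"
    unfolding decomp by (intro norm_triangle_le add_mono)
qed

end

section \<open>The estimate in the space-time cone\<close>

theorem theorem2p8:
  fixes f :: "real \<Rightarrow> real"
    and \<mu> p1 a b \<eta> :: real
    and u0 :: "(real \<Rightarrow> complex) \<Rightarrow> complex"
    and Fu0 w :: "real \<Rightarrow> complex"
    and u :: "real \<Rightarrow> real \<Rightarrow> complex"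
  assumes f_smooth: "smooth_poly_growth f"
    and f_convex: "\<And>p. deriv (deriv f) p > 0"
    and mu: "0 < \<mu>" "\<mu> \<le> 1"
    and u0: "tempered_distribution u0"
    and Fu0: "represents_distribution Fu0 (fourier_distribution u0)"
    and Fu0_L1: "integrable lborel Fu0"
    and w_bounded: "bounded (range w)"
    and w_diff: "\<And>p. w differentiable (at p)"
    and w'_L1: "integrable lborel (\<lambda>p. vector_derivative w (at p))"
    and w_p1: "\<mu> \<noteq> 1 \<Longrightarrow> w p1 \<noteq> 0"
    and Fu0_eq: "\<And>p. p \<noteq> p1 \<Longrightarrow> Fu0 p = of_real (\<bar>p - p1\<bar> powr (\<mu> - 1)) * w p"
    and u: "\<And>t x. t > 0 \<Longrightarrow>
      u t x = 1 / (2 * of_real pi) *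
        (LINT p|lborel. Fu0 p * exp (- \<i> * of_real t * of_real (f p) + \<i> * of_real x * of_real p))"
    and ab: "a < b"
    and p1: "p1 \<notin> {a..b}"
    and eta: "\<eta> \<in> {0<..<min \<bar>a - p1\<bar> \<bar>p1 - b\<bar>}"
  shows "const_m1 f a b \<eta> > 0 \<and> const_m2 f a \<eta> > 0 \<and> const_m3 f b \<eta> > 0 \<and>
    (\<forall>(t, x) \<in> space_time_cone (deriv f a) (deriv f b).
       norm (u t x) \<le> const_c1 f w \<mu> p1 a b \<eta> * t powr (- 1 / 2)
                     + const_c2 f w \<mu> p1 a b \<eta> * t powr (- \<mu>)
                     + const_c3 f w \<mu> p1 a b \<eta> * t powr (- 1))"
proof -
  let ?g = "deriv (deriv f)"
  have smooth: "(deriv ^^ n) f differentiable (at p)" for n p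
    using f_smooth unfolding smooth_poly_growth_def by blast
  have df: "(f has_real_derivative deriv f p) (at p)" for p
    using smooth[of 0 p] by (simp add: DERIV_deriv_iff_real_differentiable)
  have ddf: "(deriv f has_real_derivative ?g p) (at p)" for p
    using smooth[of 1 p] by (simp add: DERIV_deriv_iff_real_differentiable)
  have g_cont: "continuous_on T ?g" for T
    using smooth[of 2] by (intro continuous_at_imp_continuous_on) (auto simp: numeral_2_eq_2 differentiable_imp_continuous_within)
  have incr: "deriv f x < deriv f y" if "x < y" for x y
    using DERIV_pos_imp_increasing[OF that] ddf f_convex by blast
  from eta have eta0: "0 < \<eta>" "\<eta> < \<bar>a - p1\<bar>" "\<eta> < \<bar>p1 - b\<bar>" by auto
  have m2: "const_m2 f a \<eta> > 0" and m3: "const_m3 f b \<eta> > 0"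
    unfolding const_m2_def const_m3_def using incr eta0 by auto
  \<comment> \<open>\<open>LEAST\<close> over the reals is meaningful only if a least element
    exists; compactness and continuity of the second derivative provide it.\<close>
  have "compact {a - \<eta>..b + \<eta>}" "{a - \<eta>..b + \<eta>} \<noteq> {}" using eta0 ab by auto
  then obtain z where z: "z \<in> {a - \<eta>..b + \<eta>}" "\<And>y. y \<in> {a - \<eta>..b + \<eta>} \<Longrightarrow> ?g z \<le> ?g y"
    using continuous_attains_inf[OF _ _ g_cont] by meson
  have m1_eq: "const_m1 f a b \<eta> = ?g z"
    unfolding const_m1_def by (rule Least_equality) (use z in auto)
  have m1: "const_m1 f a b \<eta> > 0" "\<And>y. y \<in> {a - \<eta>..b + \<eta>} \<Longrightarrow> const_m1 f a b \<eta> \<le> ?g y"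
    unfolding m1_eq using f_convex z by auto
  have dw: "(w has_vector_derivative vector_derivative w (at p)) (at p)" for p
    using w_diff vector_derivative_works by blast
  have w_cont: "continuous_on UNIV w"
    using dw by (intro continuous_at_imp_continuous_on) (blast intro: has_vector_derivative_continuous)
  have w_le: "norm (w p) \<le> const_A w" for p
    unfolding const_A_def by (rule norm_le_Linf_norm[OF w_cont w_bounded])
  have w'_norm: "integrable lborel (\<lambda>p. norm (vector_derivative w (at p)))"
    using w'_L1 by simp
  have "norm (u t x) \<le> const_c1 f w \<mu> p1 a b \<eta> * t powr (- 1 / 2)
                     + const_c2 f w \<mu> p1 a b \<eta> * t powr (- \<mu>)
                     + const_c3 f w \<mu> p1 a b \<eta> * t powr (- 1)"
    if "(t, x) \<in> space_time_cone (deriv f a) (deriv f b)" for t x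
  proof -
    from that have t: "t > 0" and v: "deriv f a \<le> x / t" "x / t \<le> deriv f b"
      by (auto simp: space_time_cone_def)
    \<comment> \<open>Factoring \<open>t\<close> out of the exponent leaves a phase that depends on
      \<open>(t, x)\<close> only through the velocity \<open>x / t\<close>.\<close>
    define \<psi> where "\<psi> p = f p - x / t * p" for p
    define I where "I p = of_real (\<bar>p - p1\<bar> powr (\<mu> - 1)) * w p * exp (- \<i> * of_real (t * \<psi> p))" for p
    define J where "J p = Fu0 p * exp (- \<i> * of_real t * of_real (f p) + \<i> * of_real x * of_real p)" for p
    have JI: "J p = I p" if "p \<noteq> p1" for p
    proof -
      have "t * \<psi> p = t * f p - x * p" using t by (simp add: \<psi>_def field_simps)
      then have "- \<i> * of_real (t * \<psi> p) = - \<i> * of_real t * of_real (f p) + \<i> * of_real x * of_real p"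
        by (simp only: of_real_diff of_real_mult) (simp add: algebra_simps)
      then show ?thesis unfolding I_def J_def Fu0_eq[OF that] by simp
    qed
    have f_cont: "continuous_on UNIV f"
      using df by (intro continuous_at_imp_continuous_on) (blast intro: DERIV_isCont)
    have J_int: "integrable lborel J"
    proof (rule Bochner_Integration.integrable_bound[OF Fu0_L1])
      have [measurable]: "f \<in> borel_measurable borel" using f_cont by (rule borel_measurable_continuous_onI)
      have [measurable]: "Fu0 \<in> borel_measurable borel" using borel_measurable_integrable[OF Fu0_L1] by simp
      show "J \<in> borel_measurable lborel" unfolding J_def by measurable
      show "AE p in lborel. norm (J p) \<le> norm (Fu0 p)"
        unfolding J_def by (simp add: norm_mult)
    qed
    \<comment> \<open>At \<open>p1\<close> the value of \<open>Fu0\<close> is unconstrained, so the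
      two integrands may differ there, on a null set.\<close>
    have J_I: "(J has_integral y) UNIV \<longleftrightarrow> (I has_integral y) UNIV" for y
      by (rule has_integral_spike_eq[of "{p1}"]) (auto simp: JI)
    have I_has: "(I has_integral (LINT p|lborel. J p)) UNIV"
      using has_integral_integral_lborel[OF J_int] J_I by blast
    interpret singular_oscillatory_integral w "\<lambda>p. vector_derivative w (at p)" \<psi>
      "\<lambda>p. deriv f p - x / t" ?g \<mu> p1 t "const_A w"
    proof
      show "(\<psi> has_real_derivative deriv f p - x / t) (at p)" for p
        unfolding \<psi>_def using t by (auto intro!: derivative_eq_intros df)
      show "((\<lambda>p. deriv f p - x / t) has_real_derivative ?g p) (at p)" for p
        by (auto intro!: derivative_eq_intros ddf)
      show "(\<lambda>p. norm (vector_derivative w (at p))) integrable_on UNIV"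
        by (rule integrable_on_lborel[OF w'_norm])
      show "(\<lambda>p. of_real (\<bar>p - p1\<bar> powr (\<mu> - 1)) * w p * exp (- \<i> * of_real (t * \<psi> p))) integrable_on UNIV"
        using I_has unfolding I_def by blast
    qed (use t mu w_le dw f_convex[THEN less_imp_le] in auto)
    have FI: "F = I" by (simp add: fun_eq_iff F_def I_def)
    have u_eq: "norm (u t x) = norm (integral UNIV F) / (2 * pi)"
      unfolding u[OF t] FI integral_unique[OF I_has] J_def[symmetric]
      by (simp add: norm_mult norm_divide)
    have BB: "B = const_B w"
      unfolding B_def unfolding const_B_def const_A_def L1_norm_def
      using integral_lborel[OF w'_norm] by simp
    \<comment> \<open>Membership in the cone says that \<open>x / t\<close> lies between the values
      of \<open>deriv f\<close> at \<open>a\<close> and \<open>b\<close>, so the stationary point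
      exists in between.\<close>
    have "\<exists>p0\<ge>a. p0 \<le> b \<and> deriv f p0 = x / t"
      using v ab ddf by (intro IVT) (auto intro: DERIV_isCont)
    then obtain p0 where p0: "a \<le> p0" "p0 \<le> b" "deriv f p0 = x / t" by blast
    \<comment> \<open>The cone inequalities replace \<open>x / t\<close> by \<open>deriv f a\<close>
      or \<open>deriv f b\<close>, which makes the separation constants uniform in
      \<open>(t, x)\<close>.\<close>
    have side: "p0 \<in> {a - \<eta>..b + \<eta>}" "deriv f p0 - x / t = 0" "a - \<eta> \<le> b + \<eta>"
      "deriv f (a - \<eta>) - x / t \<le> - const_m2 f a \<eta>" "const_m3 f b \<eta> \<le> deriv f (b + \<eta>) - x / t"
      using p0 eta0 v ab unfolding const_m2_def const_m3_def by auto
    have tm: "t powr (-1) = 1 / t" using t by (simp add: powr_minus divide_inverse)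
    \<comment> \<open>Division by 2 \<pi> brings the bound into the shape of the three constants.
      Variables stand for the compound terms so that the algebra does not rewrite inside
      them.\<close>
    have collect: "(2 * S * (\<alpha> + \<beta> / m) * T + 2 * (\<alpha> / \<mu> + \<beta> / k) * R + Z * \<beta> / (t * l)) / (2 * pi)
        = S / pi * (\<alpha> + \<beta> * inverse m) * T + 1 / pi * (1 / \<mu> * \<alpha> + \<beta> * inverse k) * R
          + Z / (2 * pi) * \<beta> * inverse l * (1 / t)" for S \<alpha> \<beta> m T k R Z l :: real
      by (simp add: inverse_eq_divide add_divide_distrib algebra_simps)
    show ?thesis
    proof (cases "p1 < a")
      case True
      then have q: "p1 < a - \<eta>" using eta0 by auto
      have "norm (integral UNIV F) \<le> 2 * (a - \<eta> - p1) powr (\<mu> - 1) * (const_A w + B / const_m1 f a b \<eta>) * t powr (- 1 / 2)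
          + 2 * (const_A w / \<mu> + B / const_m2 f a \<eta>) * t powr (- \<mu>)
          + (b + \<eta> - p1) powr (\<mu> - 1) * B / (t * const_m3 f b \<eta>)"
        by (rule integral_bound_singularity_left[OF q side(3,1,2) m1 m2 side(4) m3 side(5)])
      from divide_right_mono[OF this, of "2 * pi"] show ?thesis
        unfolding u_eq const_c1_def const_c2_def const_c3_def if_P[OF True] tm
        unfolding collect BB by simp
    next
      case False
      then have q: "b + \<eta> < p1" using eta0 p1 by auto
      have "norm (integral UNIV F) \<le> 2 * (p1 - (b + \<eta>)) powr (\<mu> - 1) * (const_A w + B / const_m1 f a b \<eta>) * t powr (- 1 / 2)
          + 2 * (const_A w / \<mu> + B / const_m3 f b \<eta>) * t powr (- \<mu>)
          + (p1 - (a - \<eta>)) powr (\<mu> - 1) * B / (t * const_m2 f a \<eta>)"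
        by (rule integral_bound_singularity_right[OF q side(3,1,2) m1 m2 side(4) m3 side(5)])
      moreover have "p1 - (b + \<eta>) = p1 - b - \<eta>" "p1 - (a - \<eta>) = p1 - a + \<eta>" by simp_all
      ultimately have "norm (integral UNIV F) \<le> 2 * (p1 - b - \<eta>) powr (\<mu> - 1) * (const_A w + B / const_m1 f a b \<eta>) * t powr (- 1 / 2)
          + 2 * (const_A w / \<mu> + B / const_m3 f b \<eta>) * t powr (- \<mu>)
          + (p1 - a + \<eta>) powr (\<mu> - 1) * B / (t * const_m2 f a \<eta>)"
        by (simp only:)
      from divide_right_mono[OF this, of "2 * pi"] show ?thesis
        unfolding u_eq const_c1_def const_c2_def const_c3_def if_not_P[OF False] tm
        unfolding collect BB by simp
    qed
  qed
  then show ?thesis using m1(1) m2 m3 by blast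
qed

end
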